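(* Let $b\ge2$ be an integer and $c>1$ real such that $\alpha=\log_b c$ is irrational. Put $$C_b=\frac{\sqrt b+1}{\sqrt b-1}.$$ Suppose that for integers $m,q\ge1$, $$m,m+q,\ldots,m+(\ell-1)q\in\mathcal S_{c,b},\qquad \ell\ge3+\lceil C_b\rceil.$$ Set $p=\lfloor q\alpha\rfloor$, $g=\gcd(p,q)$, $a=p/g$, $d=q/g$, where $\gcd(0,q)=q$. Then $a/d$ is a regular continued-fraction convergent of $\alpha$, approached from below: $d\alpha-a>0$. Equivalently, the rational number $p/q$, written in lowest terms, is a positive-error convergent of $\alpha$. In particular, if $\gcd(p,q)=1$, then $q$ itself is a convergent denominator.
   Context: $\mathcal S_{c,b}$ is the set of integers $m\ge1$ for which there is an integer $k\ge0$ with $mb^k\le c^m<(m+1)b^k$. A convergent $a/d$ of $\alpha$ has positive error if $d\alpha-a>0$. *)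

theory Defs
  imports Complex_Main
begin

definition leading_set :: "real \<Rightarrow> nat \<Rightarrow> nat set" (\<open>\<S>\<close>) where
  "leading_set c b = {m. m \<ge> 1 \<and>
     (\<exists>k::nat. real m * real b ^ k \<le> c ^ m \<and> c ^ m < (real m + 1) * real b ^ k)}"

definition C_const :: "nat \<Rightarrow> real" where
  "C_const b = (sqrt (real b) + 1) / (sqrt (real b) - 1)"

text \<open>
  The regular continued fraction \<open>x = [a\<^sub>0; a\<^sub>1, a\<^sub>2, \<dots>]\<close> of an irrational number \<open>x\<close>, with complete
  quotients \<open>x\<^sub>0 = x\<close>, \<open>x\<^sub>n\<^sub>+\<^sub>1 = 1 / (x\<^sub>n - a\<^sub>n)\<close> and partial quotients \<open>a\<^sub>n = \<lfloor>x\<^sub>n\<rfloor>\<close>. For rational \<open>x\<close> the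
  expansion should stop once \<open>x\<^sub>n\<close> is an integer; the functions below do not model that and are
  meaningful only for irrational \<open>x\<close>.
\<close>

fun cf_complete :: "real \<Rightarrow> nat \<Rightarrow> real" where
  "cf_complete x 0 = x"
| "cf_complete x (Suc n) = 1 / frac (cf_complete x n)"

definition cf_quotient :: "real \<Rightarrow> nat \<Rightarrow> int" where
  "cf_quotient x n = \<lfloor>cf_complete x n\<rfloor>"

fun cf_num :: "real \<Rightarrow> nat \<Rightarrow> int" where
  "cf_num x 0 = cf_quotient x 0"
| "cf_num x (Suc 0) = cf_quotient x 1 * cf_quotient x 0 + 1"
| "cf_num x (Suc (Suc n)) = cf_quotient x (Suc (Suc n)) * cf_num x (Suc n) + cf_num x n"

fun cf_den :: "real \<Rightarrow> nat \<Rightarrow> int" where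
  "cf_den x 0 = 1"
| "cf_den x (Suc 0) = cf_quotient x 1"
| "cf_den x (Suc (Suc n)) = cf_quotient x (Suc (Suc n)) * cf_den x (Suc n) + cf_den x n"

text \<open>
  The fraction is given by its numerator and denominator; the convergents are in lowest terms with
  positive denominator, so \<open>a\<close> and \<open>d\<close> have to be the reduced ones.
\<close>

definition cf_convergent :: "real \<Rightarrow> int \<Rightarrow> int \<Rightarrow> bool" where
  "cf_convergent x a d \<longleftrightarrow> (\<exists>n. a = cf_num x n \<and> d = cf_den x n)"

definition positive_error_convergent :: "real \<Rightarrow> int \<Rightarrow> int \<Rightarrow> bool" where
  "positive_error_convergent x a d \<longleftrightarrow>
     cf_convergent x a d \<and> real_of_int d * x - real_of_int a > 0"

definition cf_convergent_denominator :: "real \<Rightarrow> int \<Rightarrow> bool" where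
  "cf_convergent_denominator x d \<longleftrightarrow> (\<exists>n. d = cf_den x n)"

end

theory Submission
  imports Defs "HOL-Analysis.Harmonic_Numbers"
begin

text \<open>
  Write \<open>n\<^sub>j = m + j q\<close> and \<open>\<theta> = q \<alpha> - p\<close>, the fractional part of \<open>q \<alpha>\<close>. By Legendre's criterion
  (\<open>legendre_convergent\<close>) it is enough to show \<open>q \<theta> < 1/2\<close>: dividing \<open>p\<close> and \<open>q\<close> by their gcd \<open>g\<close> divides
  \<open>q \<theta>\<close> by \<open>g\<^sup>2\<close>. The error is positive because \<open>p\<close> is a floor and \<open>\<alpha>\<close> is irrational.

  Taking logarithms to base \<open>b\<close>, \<open>n\<^sub>j \<in> \<S>\<close> means that \<open>n\<^sub>j \<alpha>\<close> lies in the interval from \<open>log n\<^sub>j\<close> to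
  \<open>log (n\<^sub>j + 1)\<close>, shifted by an integer \<open>k\<^sub>j\<close>. Unless \<open>n\<^sub>j\<close> is small compared with \<open>q\<close>, passing from
  \<open>j\<close> to \<open>j + 1\<close> changes this integer by exactly \<open>p\<close>, since any other change exceeds the width of what
  the logarithms allow (\<open>exponent_step\<close>). Removing these integers, the points \<open>A + j \<theta>\<close> of one affine
  function all lie in the thin strip from \<open>log n\<^sub>j\<close> to \<open>log (n\<^sub>j + 1)\<close> (\<open>progression_log_strip\<close>).

  This has two consequences. The strip is curved, so a straight line stays in it for a long time only
  if the strip is nearly flat there: containing the indices \<open>i\<close>, \<open>i + r\<close>, \<open>i + 2 r\<close> forces
  \<open>r\<^sup>2 q\<^sup>2 \<le> 2 n\<^bsub>i+r\<^esub>\<close> (\<open>log_strip_curvature\<close>). And the slope of the line is at most that of the strip plus its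
  thickness: \<open>r \<theta> ln b < (r q + 1) / n\<^sub>i\<close> (\<open>log_strip_slope\<close>). The first makes the middle of the run at
  least of order \<open>q\<^sup>2\<close>, and the second, applied to the right half of the run, then gives about
  \<open>q \<theta> < 2 / (r\<^sup>2 ln b)\<close>.

  The number \<open>C\<^sub>b\<close> decreases in \<open>b\<close>, so small bases come with long runs: \<open>r = 3\<close> is available
  for \<open>b = 2\<close> and \<open>r = 2\<close> for all larger bases, and this is enough. The tightest base is \<open>b = 3\<close>, where the
  middle of the run has to be moved one step to the right to absorb the lower-order terms
  (\<open>frac_bound_base_3\<close>).
\<close>

section \<open>Legendre's criterion for convergents\<close>

definition cf_error :: "real \<Rightarrow> nat \<Rightarrow> real" where
  "cf_error x n = real_of_int (cf_den x n) * x - real_of_int (cf_num x n)"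

lemma cf_complete_irrational:
  assumes "x \<notin> \<rat>"
  shows "cf_complete x n \<notin> \<rat>"
proof (induction n)
  case 0
  then show ?case using assms by simp
next
  case (Suc n)
  show ?case
  proof
    assume "cf_complete x (Suc n) \<in> \<rat>"
    then have "inverse (cf_complete x (Suc n)) \<in> \<rat>" by (rule Rats_inverse)
    then have "frac (cf_complete x n) + of_int \<lfloor>cf_complete x n\<rfloor> \<in> \<rat>"
      by (intro Rats_add) auto
    then show False using Suc by (simp add: frac_def)
  qed
qed

lemma frac_cf_complete_pos:
  assumes "x \<notin> \<rat>"
  shows "frac (cf_complete x n) > 0"
proof -
  have "cf_complete x n \<notin> \<int>"
    using cf_complete_irrational[OF assms] Ints_subset_Rats by blast
  then show ?thesis by simp
qed

lemma cf_quotient_Suc_ge_1: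
  assumes "x \<notin> \<rat>"
  shows "cf_quotient x (Suc n) \<ge> 1"
  using frac_cf_complete_pos[OF assms, of n] frac_lt_1[of "cf_complete x n"]
  by (simp add: cf_quotient_def le_floor_iff)

lemma cf_den_bounds:
  assumes "x \<notin> \<rat>"
  shows "cf_den x n \<ge> 1 \<and> cf_den x n \<ge> int n"
proof (induction n rule: induct_nat_012)
  case 0
  then show ?case by simp
next
  case 1
  then show ?case using cf_quotient_Suc_ge_1[OF assms, of 0] by simp
next
  case (ge2 n)
  have "cf_den x (Suc n) \<le> cf_quotient x (Suc (Suc n)) * cf_den x (Suc n)"
    using cf_quotient_Suc_ge_1[OF assms, of "Suc n"] ge2 by simp
  then show ?case unfolding cf_den.simps using ge2 by linarith
qed

lemma cf_complete_split: "cf_complete x n = of_int (cf_quotient x n) + frac (cf_complete x n)"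
  by (simp add: cf_quotient_def frac_def)

text \<open>
  The errors satisfy the same three-term recurrence as numerators and denominators. Since
  \<open>x\<^bsub>n+1\<^esub> frac x\<^sub>n = 1\<close> for the complete quotients, the induction hypothesis says that the older error is
  \<open>- x\<^bsub>n+1\<^esub>\<close> times the newer one, and the partial quotient cancels all of \<open>x\<^bsub>n+1\<^esub>\<close> but its fractional part.
\<close>

lemma cf_error_Suc:
  assumes "x \<notin> \<rat>"
  shows "cf_error x (Suc n) = - frac (cf_complete x (Suc n)) * cf_error x n"
proof (induction n)
  case 0
  have "cf_complete x 1 * frac x = 1"
    using frac_cf_complete_pos[OF assms, of 0] by simp
  moreover have "cf_error x 0 = frac x"
    by (simp add: cf_error_def frac_def cf_quotient_def)
  moreover have "cf_error x 1 = cf_quotient x 1 * frac x - 1"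
    by (simp add: cf_error_def frac_def cf_quotient_def algebra_simps)
  ultimately show ?case
    by (subst (asm) cf_complete_split) (simp add: algebra_simps del: cf_complete.simps)
next
  case (Suc n)
  let ?f = "frac (cf_complete x (Suc n))"
  have "cf_complete x (Suc (Suc n)) * ?f = 1"
    using frac_cf_complete_pos[OF assms, of "Suc n"] by simp
  then have E: "cf_error x n = - cf_complete x (Suc (Suc n)) * cf_error x (Suc n)"
    unfolding Suc by (simp del: cf_complete.simps)
  have "cf_error x (Suc (Suc n))
      = cf_quotient x (Suc (Suc n)) * cf_error x (Suc n) + cf_error x n"
    by (simp add: cf_error_def algebra_simps)
  also have "\<dots> = - frac (cf_complete x (Suc (Suc n))) * cf_error x (Suc n)"
    unfolding E by (subst cf_complete_split[of x "Suc (Suc n)"]) (simp add: algebra_simps del: cf_complete.simps)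
  finally show ?case .
qed

lemma cf_error_nonzero:
  assumes "x \<notin> \<rat>"
  shows "cf_error x n \<noteq> 0"
proof (induction n)
  case 0
  then show ?case using frac_cf_complete_pos[OF assms, of 0]
    by (simp add: cf_error_def frac_def cf_quotient_def)
next
  case (Suc n)
  then show ?case
    using cf_error_Suc[OF assms, of n] frac_cf_complete_pos[OF assms, of "Suc n"] by simp
qed

lemma cf_error_alternates:
  assumes "x \<notin> \<rat>"
  shows "cf_error x n * cf_error x (Suc n) < 0"
proof -
  have "cf_error x n * cf_error x n > 0"
    using cf_error_nonzero[OF assms, of n] not_real_square_gt_zero by blast
  then have "frac (cf_complete x (Suc n)) * (cf_error x n * cf_error x n) > 0"
    by (rule mult_pos_pos[OF frac_cf_complete_pos[OF assms]])
  then show ?thesis unfolding cf_error_Suc[OF assms, of n]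
    by (simp add: mult.left_commute del: cf_complete.simps)
qed

lemma cf_determinant:
  "cf_num x (Suc n) * cf_den x n - cf_num x n * cf_den x (Suc n) = (- 1) ^ n"
  by (induction n) (simp_all add: algebra_simps)

text \<open>
  Let \<open>n\<close> be such that \<open>Q\<^sub>n \<le> d < Q\<^bsub>n+1\<^esub>\<close>. Two consecutive convergents form a basis of the integer
  lattice, so \<open>(a, d)\<close> is \<open>u\<close> times the \<open>n\<close>-th plus \<open>v\<close> times the next one. If \<open>v \<noteq> 0\<close>, the size of \<open>d\<close> forces
  \<open>u\<close> and \<open>v\<close> to have opposite signs; as the errors alternate, the two contributions to \<open>d x - a\<close> add up
  and \<open>d x - a\<close> is at least as large as the \<open>n\<close>-th error. Then the nonzero integer \<open>a Q\<^sub>n - P\<^sub>n d\<close> would have absolute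
  value below \<open>1\<close>. So \<open>v = 0\<close>, and coprimality gives \<open>u = 1\<close>.
\<close>

lemma legendre_convergent:
  fixes x :: real and a d :: int
  assumes x: "x \<notin> \<rat>" and d: "d \<ge> 1" and "coprime a d"
    and close: "2 * d * \<bar>d * x - a\<bar> < 1"
  shows "cf_convergent x a d"
proof -
  let ?P = "cf_num x" and ?Q = "cf_den x"
  define k where "k = (LEAST k. d < ?Q k)"
  have "d < ?Q (Suc (nat d))"
    using cf_den_bounds[OF x, of "Suc (nat d)"] d by linarith
  then have k: "d < ?Q k" unfolding k_def by (rule LeastI)
  then obtain n where n: "k = Suc n" using d by (cases k) auto
  have Qn: "?Q n \<le> d"
    using not_less_Least[of n "\<lambda>k. d < ?Q k"] n k_def by simp
  have Qn1: "?Q n \<ge> 1" using cf_den_bounds[OF x] by blast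
  have Qk: "d < ?Q (Suc n)" using k n by simp
  define w :: int where "w = (- 1) ^ n"
  have ww: "w * w = 1" "\<bar>w\<bar> = 1" by (simp_all add: w_def flip: power_mult_distrib)
  have det: "?P (Suc n) * ?Q n - ?P n * ?Q (Suc n) = w"
    by (simp add: cf_determinant w_def)
  \<comment> \<open>Cramer's rule; multiplying by \<open>w\<close> is dividing by the determinant.\<close>
  define v where "v = w * (a * ?Q n - ?P n * d)"
  define u where "u = w * (?P (Suc n) * d - a * ?Q (Suc n))"
  have "u * ?Q n + v * ?Q (Suc n) = w * d * (?P (Suc n) * ?Q n - ?P n * ?Q (Suc n))"
    by (simp add: u_def v_def algebra_simps)
  then have du: "d = u * ?Q n + v * ?Q (Suc n)"
    unfolding det using ww by (simp add: algebra_simps)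
  have "u * ?P n + v * ?P (Suc n) = w * a * (?P (Suc n) * ?Q n - ?P n * ?Q (Suc n))"
    by (simp add: u_def v_def algebra_simps)
  then have au: "a = u * ?P n + v * ?P (Suc n)"
    unfolding det using ww by (simp add: algebra_simps)
  have "v = 0"
  proof (rule ccontr)
    assume v: "v \<noteq> 0"
    have uv: "u * v < 0"
    proof (cases "v > 0")
      case True
      then have "1 * ?Q (Suc n) \<le> v * ?Q (Suc n)" using Qk d by (intro mult_right_mono) auto
      then have "u * ?Q n < 0" using du Qk by linarith
      then have "u < 0" using Qn1 by (simp add: mult_less_0_iff)
      then show ?thesis using True by (simp add: mult_less_0_iff)
    next
      case False
      then have "v < 0" using v by simp
      then have "v * ?Q (Suc n) < 0" using Qk d by (simp add: mult_less_0_iff)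
      then have "u * ?Q n > 0" using du d by linarith
      then have "u > 0" using Qn1 by (simp add: zero_less_mult_iff)
      then show ?thesis using \<open>v < 0\<close> by (simp add: mult_less_0_iff)
    qed
    let ?E = "cf_error x n" and ?F = "cf_error x (Suc n)"
    have dec: "d * x - a = u * ?E + v * ?F"
      by (subst du, subst au) (simp add: cf_error_def algebra_simps)
    have "(u * ?E) * (v * ?F) = of_int (u * v) * (?E * ?F)" by simp
    also have "\<dots> > 0"
      using uv cf_error_alternates[OF x, of n] by (intro mult_neg_neg) (simp_all only: of_int_less_0_iff)
    finally have "\<bar>d * x - a\<bar> = \<bar>u * ?E\<bar> + \<bar>v * ?F\<bar>"
      unfolding dec by (subst (asm) zero_less_mult_iff) linarith
    moreover have "\<bar>u * ?E\<bar> \<ge> 1 * \<bar>?E\<bar>"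
      unfolding abs_mult using uv by (intro mult_right_mono) (auto simp: mult_less_0_iff)
    ultimately have E: "\<bar>?E\<bar> \<le> \<bar>d * x - a\<bar>" by linarith
    have "\<bar>a * ?Q n - ?P n * d\<bar> \<ge> 1" using v by (auto simp: v_def)
    then have "1 \<le> \<bar>of_int (a * ?Q n - ?P n * d) :: real\<bar>" by linarith
    also have "of_int (a * ?Q n - ?P n * d) = d * ?E - ?Q n * (d * x - a)"
      by (simp add: cf_error_def algebra_simps)
    also have "\<bar>\<dots>\<bar> \<le> \<bar>d * ?E\<bar> + \<bar>?Q n * (d * x - a)\<bar>" by (rule abs_triangle_ineq4)
    also have "\<dots> \<le> d * \<bar>d * x - a\<bar> + d * \<bar>d * x - a\<bar>"
      unfolding abs_mult using E d Qn Qn1 by (intro add_mono mult_mono) auto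
    also have "\<dots> < 1" using close by simp
    finally show False by simp
  qed
  then have "a = u * ?P n" "d = u * ?Q n" using au du by auto
  moreover have "u = 1"
  proof -
    have "u dvd a" "u dvd d" using calculation by (metis dvd_triv_left)+
    then have "u dvd 1" by (rule coprime_common_divisor[OF \<open>coprime a d\<close>])
    moreover have "u * ?Q n > 0" using \<open>d = u * ?Q n\<close> d by linarith
    then have "u > 0" using Qn1 by (simp add: zero_less_mult_iff)
    ultimately show ?thesis by simp
  qed
  ultimately show ?thesis unfolding cf_convergent_def by auto
qed

section \<open>An affine function in a logarithmic strip\<close>

definition log_strip :: "nat \<Rightarrow> nat \<Rightarrow> nat \<Rightarrow> real \<Rightarrow> real \<Rightarrow> nat \<Rightarrow> bool" where
  "log_strip b m q A t j \<longleftrightarrow>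
     log b (m + j * q) \<le> A + j * t \<and> A + j * t < log b (m + j * q + 1)"

lemma leading_set_log:
  assumes "b \<ge> 2" "c > 1" "n \<in> \<S> c b"
  obtains k :: nat where "k + log b n \<le> n * log b c" "n * log b c < k + log b (n + 1)"
proof -
  obtain k where n: "n \<ge> 1" and k: "n * real b ^ k \<le> c ^ n" "c ^ n < (real n + 1) * real b ^ k"
    using assms(3) by (auto simp: leading_set_def)
  have c: "log b (c ^ n) = n * log b c" using assms by (simp add: log_nat_power)
  have "log b (n * real b ^ k) \<le> log b (c ^ n)" using k n assms by simp
  moreover have "log b (n * real b ^ k) = k + log b n"
    using n assms by (simp add: log_mult log_nat_power)
  moreover have "log b (c ^ n) < log b ((real n + 1) * real b ^ k)"
    using k assms by (simp add: pos_add_strict)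
  moreover have "log b ((real n + 1) * real b ^ k) = k + log b (n + 1)"
    using n assms by (simp add: log_mult log_nat_power add.commute)
  ultimately show ?thesis using c that[of k] by (simp add: add.commute)
qed

text \<open>
  As \<open>q \<alpha>\<close> lies in \<open>[p, p + 1)\<close>, the integer \<open>k' - k - p\<close> is strictly between \<open>-1\<close> and \<open>1\<close>: it is below \<open>1\<close>
  because \<open>log (n + 1) \<le> log (n + q)\<close>, and above \<open>-1\<close> because
  from \<open>n\<close> to \<open>n + q + 1\<close> the logarithm to base \<open>b\<close> grows by at most \<open>1\<close>, which is the
  condition \<open>n + q + 1 \<le> b n\<close>.
\<close>

lemma exponent_step:
  fixes b n q :: nat and k k' p :: int and \<alpha> :: real
  assumes b: "b \<ge> 2" and n: "n \<ge> 1" and q: "q \<ge> 1"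
    and wide: "q + 1 \<le> (b - 1) * n"
    and k: "k + log b n \<le> n * \<alpha>" "n * \<alpha> < k + log b (n + 1)"
    and k': "k' + log b (n + q) \<le> (n + q) * \<alpha>" "(n + q) * \<alpha> < k' + log b (n + q + 1)"
    and p: "p = \<lfloor>q * \<alpha>\<rfloor>"
  shows "k' = k + p"
proof -
  have fl: "p \<le> q * \<alpha>" "q * \<alpha> < p + 1" using p by linarith+
  have sp: "(n + q) * \<alpha> = n * \<alpha> + q * \<alpha>" by (simp add: algebra_simps)
  have "log b (n + 1) \<le> log b (n + q)" using b q by simp
  then have "real_of_int k' < k + p + 1" using k k' fl sp by linarith
  moreover have "real_of_int k' > k + p - 1"
  proof -
    have "n + q + 1 \<le> b * n" using wide b by (cases b) auto
    then have "real (n + q + 1) \<le> real b * real n" by (simp only: flip: of_nat_mult of_nat_le_iff)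
    then have "log b (n + q + 1) \<le> log b (real b * real n)" using b by (subst log_le_cancel_iff) auto
    also have "\<dots> = 1 + log b n" using b n by (simp add: log_mult)
    finally show ?thesis using k k' fl sp by linarith
  qed
  ultimately show ?thesis by linarith
qed

text \<open>
  The growth condition of \<open>exponent_step\<close> gets easier along the progression, so it is only needed at
  the first index; from there on the exponents themselves form an arithmetic progression with
  difference \<open>p\<close>.
\<close>

lemma progression_log_strip:
  fixes b m q s e :: nat and c :: real and p :: int
  assumes b: "b \<ge> 2" and c: "c > 1" and m: "m \<ge> 1" and q: "q \<ge> 1"
    and run: "\<And>j. s \<le> j \<Longrightarrow> j \<le> e \<Longrightarrow> m + j * q \<in> \<S> c b"
    and wide: "q + 1 \<le> (b - 1) * (m + s * q)"
    and p: "p = \<lfloor>q * log b c\<rfloor>"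
  obtains A where "\<And>j. s \<le> j \<Longrightarrow> j \<le> e \<Longrightarrow> log_strip b m q A (q * log b c - p) j"
proof -
  let ?\<alpha> = "log b c"
  have "\<exists>k::nat. k + log b (m + j * q) \<le> (m + j * q) * ?\<alpha>
      \<and> (m + j * q) * ?\<alpha> < k + log b (m + j * q + 1)" if j: "s \<le> j" "j \<le> e" for j
    by (rule leading_set_log[OF b c run[OF j]], rule exI, rule conjI) (auto simp: add_ac)
  then have "\<forall>j. \<exists>k::nat. s \<le> j \<and> j \<le> e \<longrightarrow> k + log b (m + j * q) \<le> (m + j * q) * ?\<alpha>
      \<and> (m + j * q) * ?\<alpha> < k + log b (m + j * q + 1)" by blast
  from choice[OF this] obtain k :: "nat \<Rightarrow> nat" where
    k: "\<And>j. s \<le> j \<Longrightarrow> j \<le> e \<Longrightarrow> k j + log b (m + j * q) \<le> (m + j * q) * ?\<alpha>"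
       "\<And>j. s \<le> j \<Longrightarrow> j \<le> e \<Longrightarrow> (m + j * q) * ?\<alpha> < k j + log b (m + j * q + 1)"
    by blast
  have advance: "int (k (Suc j)) = int (k j) + p" if j: "s \<le> j" "Suc j \<le> e" for j
  proof (rule exponent_step[OF b _ q _ _ _ _ _ p])
    have "(b - 1) * (m + s * q) \<le> (b - 1) * (m + j * q)"
      using j by (intro mult_le_mono2 add_left_mono mult_le_mono1)
    with wide show "q + 1 \<le> (b - 1) * (m + j * q)" by (rule order.trans)
  qed (use m k[of j] k[of "Suc j"] j in \<open>auto simp: algebra_simps\<close>)
  have kj: "int (k j) = int (k s) + (int j - int s) * p" if "s \<le> j" "j \<le> e" for j
    using that
  proof (induction rule: dec_induct)
    case (step j)
    then show ?case using advance[of j] by (simp add: algebra_simps)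
  qed simp
  define A where "A = m * ?\<alpha> - k s + s * p"
  show ?thesis
  proof (rule that[of A])
    fix j assume j: "s \<le> j" "j \<le> e"
    have "real_of_int (int (k j)) = k s + (real j - real s) * p" unfolding kj[OF j] by simp
    then have "A + j * (q * ?\<alpha> - p) = (m + j * q) * ?\<alpha> - k j"
      by (simp add: A_def algebra_simps)
    then show "log_strip b m q A (q * ?\<alpha> - p) j"
      using k[OF j] by (simp add: log_strip_def add_ac)
  qed
qed

text \<open>
  Midpoint concavity, made quantitative: the middle value is the mean of the outer ones, so
  \<open>y\<^sup>2 < (x + 1) (z + 1)\<close> for the three terms \<open>x\<close>, \<open>y\<close>, \<open>z\<close>, while \<open>y\<^sup>2 - x z = (r q)\<^sup>2\<close> and \<open>x + z = 2 y\<close>.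
  Integrality removes the remaining \<open>1\<close>.
\<close>

lemma log_strip_curvature:
  assumes b: "b \<ge> 2" and m: "m \<ge> 1"
    and "log_strip b m q A t i" "log_strip b m q A t (i + r)" "log_strip b m q A t (i + 2 * r)"
  shows "r\<^sup>2 * q\<^sup>2 \<le> 2 * (m + (i + r) * q)"
proof -
  let ?x = "m + i * q" and ?y = "m + (i + r) * q" and ?z = "m + (i + 2 * r) * q"
  have "2 * log b ?y < log b (?x + 1) + log b (?z + 1)"
    using assms(3-5) by (simp add: log_strip_def algebra_simps)
  moreover have "2 * log b ?y = log b (real (?y\<^sup>2))"
    using b m by (simp add: log_nat_power)
  moreover have "log b (?x + 1) + log b (?z + 1) = log b (real ((?x + 1) * (?z + 1)))"
    using b m unfolding of_nat_mult by (subst log_mult) (auto simp del: of_nat_add of_nat_mult simp flip: of_nat_Suc)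
  ultimately have "real (?y\<^sup>2) < real ((?x + 1) * (?z + 1))"
    using b m by (subst log_less_cancel_iff[symmetric, of "real b"])
      (simp_all only: of_nat_0_less_iff, auto)
  then have "?y\<^sup>2 < (?x + 1) * (?z + 1)" by (simp only: of_nat_less_iff)
  moreover have "?y\<^sup>2 + 2 * ?y + 1 = (?x + 1) * (?z + 1) + r\<^sup>2 * q\<^sup>2"
    by (simp add: algebra_simps power2_eq_square)
  ultimately show ?thesis by linarith
qed

lemma log_strip_slope:
  assumes b: "b \<ge> 2" and m: "m \<ge> 1"
    and "log_strip b m q A t i" "log_strip b m q A t (i + r)"
  shows "r * t * ln b * (m + i * q) < r * q + 1"
proof -
  let ?n = "m + i * q"
  have n: "real ?n > 0" using m by (simp del: of_nat_add of_nat_mult)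
  have "r * t < log b (?n + (r * q + 1)) - log b ?n"
    using assms(3,4) by (simp add: log_strip_def algebra_simps)
  also have "\<dots> = ln ((?n + (r * q + 1)) / ?n) / ln b"
    using n b add_pos_nonneg[OF n, of "real (r * q + 1)"]
    by (subst ln_div) (simp_all add: log_def diff_divide_distrib)
  also have "(?n + (r * q + 1)) / ?n = 1 + (r * q + 1) / ?n"
    using n by (simp add: field_simps)
  also have "ln (1 + real (r * q + 1) / ?n) / ln b \<le> (r * q + 1) / ?n / ln b"
    using n b by (intro divide_right_mono ln_add_one_self_le_self) auto
  finally have "r * t < (r * q + 1) / ?n / ln b" .
  moreover have "0 < ln b * ?n" using n b by (intro mult_pos_pos) auto
  ultimately show ?thesis by (simp only: divide_divide_eq_left pos_less_divide_eq mult.commute mult.assoc)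
    (simp add: mult_ac)
qed

section \<open>Runs of the required length\<close>

text \<open>
  The hypothesis is \<open>sqrt b < (t + 1) / (t - 1)\<close> with roots and denominators cleared, so that it can be
  checked by computation and also makes sense for \<open>t = 1\<close>.
\<close>

lemma C_const_gt:
  fixes b :: nat and t :: real
  assumes "b \<ge> 2" "t \<ge> 1" "b * (t - 1)\<^sup>2 < (t + 1)\<^sup>2"
  shows "C_const b > t"
proof -
  have "(sqrt b * (t - 1))\<^sup>2 < (t + 1)\<^sup>2" using assms by (simp add: power_mult_distrib)
  then have "sqrt b * (t - 1) < t + 1" by (rule power2_less_imp_less) (use assms in simp)
  moreover have "sqrt b > 1" using assms by simp
  ultimately show ?thesis by (simp add: C_const_def field_simps)
qed

lemma ln_4_ge_four_thirds: "ln (4::real) \<ge> 4 / 3"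
proof -
  have "ln (4::real) = 2 * ln 2" using ln_realpow[of "2::real" 2] by simp
  then show ?thesis using ln2_ge_two_thirds by simp
qed

lemma ln_3_ge_1: "ln (3::real) \<ge> 1"
  using exp_le by (subst ln_ge_iff) auto

text \<open>
  The small value of \<open>ln 2\<close> is compensated by the step \<open>r = 3\<close>: the middle term \<open>N\<close> satisfies \<open>2 N \<ge> 9 q\<^sup>2\<close>.
\<close>

lemma frac_bound_base_2:
  assumes m: "m \<ge> 1" and q: "q \<ge> 1" and t: "t > 0"
    and s: "\<And>j. j \<le> 6 \<Longrightarrow> log_strip 2 m q A t (i + j)"
  shows "2 * q * t < 1"
proof -
  have "9 * q\<^sup>2 \<le> 2 * (m + (i + 3) * q)"
    using log_strip_curvature[of 2 m q A t i 3] m s[of 0] s[of 3] s[of 6] by simp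
  then have N: "9 * (real q)\<^sup>2 \<le> 2 * real (m + (i + 3) * q)"
    by (simp flip: of_nat_le_iff[where 'a = real])
  have "3 * t * (2 / 3) * (9 / 2 * (real q)\<^sup>2) \<le> 3 * t * ln 2 * real (m + (i + 3) * q)"
    using t N ln2_ge_two_thirds by (intro mult_mono) auto
  also have "\<dots> < 3 * q + 1"
    using log_strip_slope[of 2 m q A t "i + 3" 3] m s[of 3] s[of 6] by (simp add: add.assoc)
  also have "\<dots> \<le> 4 * real q" using q by simp
  finally have "(9 * (q * t)) * q < 4 * real q" by (simp add: power2_eq_square algebra_simps)
  then have "9 * (q * t) < 4" using q by (subst (asm) mult_less_cancel_right_pos) auto
  then show ?thesis by simp
qed

text \<open>
  Here the slope is measured from index \<open>i + 3\<close>, one step after the middle index \<open>i + 2\<close>. The extra \<open>q\<close> makes the term at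
  least \<open>2 q\<^sup>2 + q = q (2 q + 1)\<close>, which cancels the factor \<open>2 q + 1\<close> of the slope bound exactly and leaves
  \<open>2 q t < 1 / ln 3\<close>. Measured from the middle index itself, the bound
  on \<open>q t\<close> can exceed \<open>1/2\<close> for small \<open>q\<close>.
\<close>

lemma frac_bound_base_3:
  assumes m: "m \<ge> 1" and q: "q \<ge> 1" and t: "t > 0"
    and s: "\<And>j. j \<le> 5 \<Longrightarrow> log_strip 3 m q A t (i + j)"
  shows "2 * q * t < 1"
proof -
  have "4 * q\<^sup>2 \<le> 2 * (m + (i + 2) * q)"
    using log_strip_curvature[of 3 m q A t i 2] m s[of 0] s[of 2] s[of 4] by simp
  then have "2 * q\<^sup>2 + q \<le> m + (i + 3) * q" by (simp add: algebra_simps)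
  then have N: "2 * (real q)\<^sup>2 + q \<le> real (m + (i + 3) * q)"
    by (simp flip: of_nat_le_iff[where 'a = real])
  have "2 * t * 1 * (2 * (real q)\<^sup>2 + q) \<le> 2 * t * ln 3 * real (m + (i + 3) * q)"
    using t N ln_3_ge_1 by (intro mult_mono) auto
  also have "\<dots> < 2 * q + 1"
    using log_strip_slope[of 3 m q A t "i + 3" 2] m s[of 3] s[of 5] by (simp add: algebra_simps)
  finally have "(2 * q * t) * (2 * real q + 1) < 1 * (2 * real q + 1)"
    by (simp add: power2_eq_square algebra_simps)
  then show ?thesis by (subst (asm) mult_less_cancel_right_pos) auto
qed

text \<open>
  With \<open>ln b \<ge> 4/3\<close> the factor \<open>(2 q + 1) / (2 q)\<close> lost by measuring the slope from the middle index is
  harmless as soon as \<open>q \<ge> 2\<close>. For \<open>q = 1\<close> the bound \<open>2 q\<^sup>2\<close> for the middle term is replaced by the trivial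
  bound \<open>3\<close>.
\<close>

lemma frac_bound_base_ge_4:
  assumes b: "b \<ge> 4" and m: "m \<ge> 1" and q: "q \<ge> 1" and t: "t > 0"
    and s: "\<And>j. j \<le> 4 \<Longrightarrow> log_strip b m q A t (i + j)"
  shows "2 * q * t < 1"
proof -
  let ?N = "m + (i + 2) * q"
  have lnb: "ln b \<ge> 4 / 3" using ln_4_ge_four_thirds b by (intro order.trans[OF ln_4_ge_four_thirds]) auto
  have "4 * q\<^sup>2 \<le> 2 * ?N"
    using log_strip_curvature[of b m q A t i 2] b m s[of 0] s[of 2] s[of 4] by simp
  then have N: "2 * (real q)\<^sup>2 \<le> real ?N"
    by (simp flip: of_nat_le_iff[where 'a = real])
  have upper: "2 * t * ln b * real ?N < 2 * q + 1"
  proof -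
    have "log_strip b m q A t (i + 2 + 2)" using s[of 4] by (simp only: add.assoc semiring_norm)
    from log_strip_slope[OF _ m s this] show ?thesis using b by simp
  qed
  show ?thesis
  proof (cases "q = 1")
    case True
    then have "real ?N \<ge> 3" using m by simp
    then have "2 * t * (4 / 3) * 3 \<le> 2 * t * ln b * real ?N"
      using t lnb by (intro mult_mono) auto
    then show ?thesis using upper True by simp
  next
    case False
    have "2 * t * (4 / 3) * (2 * (real q)\<^sup>2) \<le> 2 * t * ln b * real ?N"
      using t lnb N by (intro mult_mono) auto
    also have "\<dots> < 2 * q + 1" by (rule upper)
    also have "\<dots> \<le> 5 / 2 * real q" using q False by simp
    finally have "(16 / 3 * (q * t)) * q < 5 / 2 * real q" by (simp add: power2_eq_square algebra_simps)
    then have "16 / 3 * (q * t) < 5 / 2" using q by (subst (asm) mult_less_cancel_right_pos) auto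
    then show ?thesis by simp
  qed
qed

text \<open>
  From index \<open>1\<close> on every term exceeds \<open>q\<close>, which is the growth condition for \<open>b = 2\<close> and more than enough
  for larger bases. Index \<open>0\<close> enters for \<open>b \<ge> 9\<close>, where the run may have just five terms. There \<open>m\<close> could fail the growth condition
  only if \<open>8 m \<le> q\<close>, and then the terms at indices \<open>1\<close>, \<open>2\<close>, \<open>3\<close> are too small for the curvature bound.
\<close>

lemma long_run_frac_bound:
  fixes b m q l :: nat and c :: real and p :: int
  assumes b: "b \<ge> 2" and c: "c > 1" and m: "m \<ge> 1" and q: "q \<ge> 1"
    and run: "\<And>j. j < l \<Longrightarrow> m + j * q \<in> \<S> c b"
    and l: "int l \<ge> 3 + \<lceil>C_const b\<rceil>"
    and p: "p = \<lfloor>q * log b c\<rfloor>" and pos: "q * log b c - p > 0"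
  shows "2 * q * (q * log b c - p) < 1"
proof -
  let ?t = "q * log b c - p"
  have long: "l \<ge> k + 4" if "k \<ge> 1" "b * (real k - 1)\<^sup>2 < (real k + 1)\<^sup>2" for k :: nat
    using C_const_gt[OF b, of "real k"] that l by linarith
  have l5: "l \<ge> 5" using long[of 1] by simp
  have wide1: "q + 1 \<le> (b - 1) * (m + 1 * q)"
  proof -
    have "q + 1 \<le> 1 * (m + 1 * q)" using m by simp
    also have "\<dots> \<le> (b - 1) * (m + 1 * q)"
      using b by (intro mult_le_mono1) simp
    finally show ?thesis .
  qed
  obtain A where A: "\<And>j. 1 \<le> j \<Longrightarrow> j \<le> l - 1 \<Longrightarrow> log_strip b m q A ?t j"
    by (rule progression_log_strip[OF b c m q _ wide1 p, of "l - 1"]) (use run l5 in auto)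
  consider "b = 2" | "b = 3" | "4 \<le> b" "b \<le> 8" | "b \<ge> 9" using b by linarith
  then show ?thesis
  proof cases
    case 1
    then have "l \<ge> 8" using long[of 4] by simp
    then show ?thesis using A 1 by (intro frac_bound_base_2[OF m q pos, of A 1]) simp
  next
    case 2
    then have "l \<ge> 7" using long[of 3] by simp
    then show ?thesis using A 2 by (intro frac_bound_base_3[OF m q pos, of A 1]) simp
  next
    case 3
    then have "l \<ge> 6" using long[of 2] by simp
    then show ?thesis using A by (intro frac_bound_base_ge_4[OF 3(1) m q pos, of A 1]) simp
  next
    case 4
    have wide0: "q + 1 \<le> (b - 1) * (m + 0 * q)"
    proof (rule ccontr)
      assume "\<not> ?thesis"
      then have "(b - 1) * m \<le> q" by simp
      moreover have "8 * m \<le> (b - 1) * m" using 4 by (intro mult_right_mono) auto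
      ultimately have mq: "8 * m \<le> q" by linarith
      have "1\<^sup>2 * q\<^sup>2 \<le> 2 * (m + (1 + 1) * q)"
        by (rule log_strip_curvature[OF b m A A A]) (use l5 in auto)
      also have "\<dots> \<le> 5 * q" using mq by simp
      finally have "q * q \<le> 5 * q" by (simp add: power2_eq_square)
      then have "q \<le> 5" using q by simp
      then show False using mq m by simp
    qed
    obtain B where B: "\<And>j. 0 \<le> j \<Longrightarrow> j \<le> l - 1 \<Longrightarrow> log_strip b m q B ?t j"
      by (rule progression_log_strip[OF b c m q _ wide0 p, of "l - 1"]) (use run l5 in auto)
    then show ?thesis
      using l5 4 by (intro frac_bound_base_ge_4[OF _ m q pos, of b B 0]) simp_all
  qed
qed

theorem corollary5p20:
  fixes b m q l :: nat and c \<alpha> :: real and p g a d :: int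
  assumes "b \<ge> 2" and "c > 1"
    and "\<alpha> = log (real b) c" and "\<alpha> \<notin> \<rat>"
    and "m \<ge> 1" and "q \<ge> 1"
    and "\<forall>j<l. m + j * q \<in> \<S> c b"
    and "int l \<ge> 3 + \<lceil>C_const b\<rceil>"
    and "p = \<lfloor>real q * \<alpha>\<rfloor>" and "g = gcd p (int q)"
    and "a = p div g" and "d = int q div g"
  shows "cf_convergent \<alpha> a d \<and> real_of_int d * \<alpha> - real_of_int a > 0
    \<and> (case quotient_of (Fract p (int q)) of (a', d') \<Rightarrow> positive_error_convergent \<alpha> a' d')
    \<and> (gcd p (int q) = 1 \<longrightarrow> cf_convergent_denominator \<alpha> (int q))"
proof -
  define t where "t = real q * \<alpha> - p"
  have "t \<noteq> 0"
  proof
    assume "t = 0"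
    then have "\<alpha> = of_int p / of_nat q"
      using assms(6) unfolding t_def by (subst eq_divide_eq) (simp add: mult.commute)
    moreover have "of_int p / of_nat q \<in> (\<rat> :: real set)" by simp
    ultimately show False using assms(4) by metis
  qed
  then have t: "t > 0" using assms(9) unfolding t_def by linarith
  have small: "2 * q * t < 1"
    using long_run_frac_bound[OF assms(1,2,5,6), of l p] assms(3,7,8,9) t
    unfolding t_def by simp
  have g: "g \<ge> 1" using assms(6,10) by (simp add: int_one_le_iff_zero_less)
  have pq: "p = g * a" "int q = g * d" using assms(10-12) by simp_all
  have "g * d > 0" using pq(2) assms(6) by linarith
  then have d: "d \<ge> 1" using g by (simp add: zero_less_mult_iff)
  have "coprime a d" using assms(6,10-12) by (simp add: div_gcd_coprime)
  have tg: "t = g * (d * \<alpha> - a)"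
  proof -
    have "real q = real_of_int g * d" using arg_cong[OF pq(2), of real_of_int] by simp
    then show ?thesis unfolding t_def pq(1) by (simp add: algebra_simps)
  qed
  have e: "d * \<alpha> - a > 0" using t g unfolding tg by (simp add: zero_less_mult_iff)
  have "2 * d * (d * \<alpha> - a) \<le> 2 * q * t"
  proof -
    have "1 * d \<le> int q" unfolding pq(2) using g d by (intro mult_right_mono) auto
    then have "real_of_int d \<le> q" by linarith
    moreover have "1 * (d * \<alpha> - a) \<le> t" unfolding tg using g e by (intro mult_right_mono) auto
    ultimately show ?thesis using d e by (intro mult_mono) auto
  qed
  then have "2 * d * \<bar>d * \<alpha> - a\<bar> < 1" using small e by simp
  then have conv: "cf_convergent \<alpha> a d"
    by (rule legendre_convergent[OF assms(4) d \<open>coprime a d\<close>])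
  moreover have "quotient_of (Fract p (int q)) = (a, d)"
    using assms(6,10-12) by (simp add: quotient_of_Fract Rat.normalize_def Let_def)
  moreover have "cf_convergent_denominator \<alpha> (int q)" if "gcd p (int q) = 1"
    using conv that assms(10,12)
    by (auto simp: cf_convergent_def cf_convergent_denominator_def)
  ultimately show ?thesis using e by (simp add: positive_error_convergent_def)
qed

end
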